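(* Let $S$ be a set of sorts and $\Sigma$ an $S$-sorted signature. The ordered set $\mathbf{Form}_{\mathrm{Alg}}(\Sigma)$ of all formations of $\Sigma$-algebras, ordered by inclusion, is an algebraic lattice; and, for every formation of $\Sigma$-algebras $\mathcal{F}$, $\mathcal{F}$ is a compact element of this lattice if, and only if, there exists a finite subset $\mathcal{M}$ of $\mathrm{Alg}(\Sigma)$ such that $\mathcal{F}=\mathrm{Fmg}_{\Sigma}(\mathcal{M})$, where $\mathrm{Fmg}_\Sigma(\mathcal{M})$ denotes the intersection of all formations of $\Sigma$-algebras that contain $\mathcal{M}$.
   Context: Fix a Grothendieck universe $\mathcal{U}$, a set of sorts $S\in\mathcal{U}$ and an $S$-sorted signature $\Sigma$, i.e. a family of sets $\Sigma_{w,s}\in\mathcal{U}$ indexed by $w\in S^{\star}$ (finite words on $S$) and $s\in S$. An $S$-sorted set is a family $A=(A_s)_{s\in S}$ of sets in $\mathcal{U}$ (components may be empty). A $\Sigma$-algebra $\mathbf{A}$ is an $S$-sorted set $A$ with an operation $F_\sigma\colon A_w=\prod_{i<|w|}A_{w_i}\to A_s$ for each $\sigma\in\Sigma_{w,s}$; homomorphisms are $S$-sorted (componentwise) mappings commuting with all operations. Epimorphism means homomorphism surjective in each sort. $\mathrm{Alg}(\Sigma)$ is the set of all $\Sigma$-algebras; a "set of $\Sigma$-algebras" is any subset of it (not necessarily $\mathcal{U}$-small). A subdirect embedding $f\colon\mathbf{A}\to\prod_{i\in I}\mathbf{C}^i$ is a homomorphism injective in each sort such that each $\mathrm{pr}^i\circ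 f\colon\mathbf{A}\to\mathbf{C}^i$ is surjective (the empty product is the final algebra $\mathbf{1}$, with one element in each sort). A formation of $\Sigma$-algebras is a set $\mathcal{F}\subseteq\mathrm{Alg}(\Sigma)$ such that: (1) $\mathcal{F}\neq\varnothing$; (2) $\mathcal{F}$ is closed under isomorphism; (3) if $\mathbf{B}\in\mathcal{F}$ and there is an epimorphism $\mathbf{B}\to\mathbf{A}$, then $\mathbf{A}\in\mathcal{F}$; (4) if for some $n\in\mathbb{N}$ (including $n=0$) and some family $(\mathbf{C}^{\alpha})_{\alpha<n}$ in $\mathcal{F}$ there is a subdirect embedding $\mathbf{A}\to\prod_{\alpha<n}\mathbf{C}^{\alpha}$, then $\mathbf{A}\in\mathcal{F}$. An algebraic lattice is a complete lattice in which every element is a join of compact elements. *)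

theory Defs
  imports "HOL-Algebra.Complete_Lattice" "HOL-Library.FuncSet"
begin

section \<open>Grothendieck universes\<close>

text \<open>
  The type \<open>'u\<close> is the universe itself and \<open>elts x\<close> is the extension of \<open>x\<close>, so transitivity is
  built into the typing. A HOL set \<open>X\<close> of type \<open>'u set\<close> is a member of the universe
  iff \<open>X \<in> range elts\<close>. Infinity is not required: universes with and without it are covered.
\<close>

locale grothendieck_universe =
  fixes elts :: "'u \<Rightarrow> 'u set"
  assumes extensionality: "inj elts"
    and foundation: "wf {(y, x). y \<in> elts x}"
    and pair: "{x, y} \<in> range elts"
    and power: "\<exists>p. elts ` elts p = Pow (elts x)"
    and union: "(\<Union>i\<in>elts x. elts (f i)) \<in> range elts"

section \<open>Many-sorted algebras\<close>

text \<open>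
  A signature is a function \<open>\<Sigma>\<close>, where \<open>\<Sigma> w s\<close> is the set of operation symbols of arity \<open>w\<close> and
  sort \<open>s\<close>; only its values at \<open>w \<in> lists S\<close> and \<open>s \<in> S\<close> matter. The sets \<open>\<Sigma> w s\<close> need not be
  disjoint, hence operations are indexed by \<open>w\<close>, \<open>s\<close> and the symbol.
\<close>

type_synonym ('s, 'f) signature = "'s list \<Rightarrow> 's \<Rightarrow> 'f set"

record ('s, 'f, 'a) sorted_algebra =
  carr :: "'s \<Rightarrow> 'a set"
  oper :: "'s list \<Rightarrow> 's \<Rightarrow> 'f \<Rightarrow> (nat \<Rightarrow> 'a) \<Rightarrow> 'a"

definition word_prod :: "('s \<Rightarrow> 'a set) \<Rightarrow> 's list \<Rightarrow> (nat \<Rightarrow> 'a) set" where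
  "word_prod A w = (\<Pi>\<^sub>E i\<in>{..<length w}. A (w ! i))"

text \<open>
  The record fields are total functions; requiring them to be \<open>undefined\<close> outside the relevant
  domains makes two algebras equal as soon as their carriers and operations agree.
\<close>

definition is_algebra :: "'s set \<Rightarrow> ('s, 'f) signature \<Rightarrow> ('s, 'f, 'a) sorted_algebra \<Rightarrow> bool" where
  "is_algebra S \<Sigma> A \<longleftrightarrow>
     carr A \<in> extensional S \<and>
     (\<forall>w s \<sigma>. if w \<in> lists S \<and> s \<in> S \<and> \<sigma> \<in> \<Sigma> w s
        then oper A w s \<sigma> \<in> word_prod (carr A) w \<rightarrow>\<^sub>E carr A s
        else oper A w s \<sigma> = undefined)"

definition Alg ::
    "('u \<Rightarrow> 'u set) \<Rightarrow> 's set \<Rightarrow> ('s, 'f) signature \<Rightarrow> ('s, 'f, 'u) sorted_algebra set" where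
  "Alg elts S \<Sigma> = {A. is_algebra S \<Sigma> A \<and> (\<forall>s\<in>S. carr A s \<in> range elts)}"

definition is_hom :: "'s set \<Rightarrow> ('s, 'f) signature \<Rightarrow> ('s, 'f, 'a) sorted_algebra \<Rightarrow>
    ('s, 'f, 'b) sorted_algebra \<Rightarrow> ('s \<Rightarrow> 'a \<Rightarrow> 'b) \<Rightarrow> bool" where
  "is_hom S \<Sigma> A B h \<longleftrightarrow>
     (\<forall>s\<in>S. h s \<in> carr A s \<rightarrow> carr B s) \<and>
     (\<forall>w\<in>lists S. \<forall>s\<in>S. \<forall>\<sigma>\<in>\<Sigma> w s. \<forall>x\<in>word_prod (carr A) w.
        h s (oper A w s \<sigma> x) = oper B w s \<sigma> (\<lambda>i\<in>{..<length w}. h (w ! i) (x i)))"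

definition is_iso :: "'s set \<Rightarrow> ('s, 'f) signature \<Rightarrow> ('s, 'f, 'a) sorted_algebra \<Rightarrow>
    ('s, 'f, 'b) sorted_algebra \<Rightarrow> ('s \<Rightarrow> 'a \<Rightarrow> 'b) \<Rightarrow> bool" where
  "is_iso S \<Sigma> A B h \<longleftrightarrow> is_hom S \<Sigma> A B h \<and> (\<forall>s\<in>S. bij_betw (h s) (carr A s) (carr B s))"

definition is_epi :: "'s set \<Rightarrow> ('s, 'f) signature \<Rightarrow> ('s, 'f, 'a) sorted_algebra \<Rightarrow>
    ('s, 'f, 'b) sorted_algebra \<Rightarrow> ('s \<Rightarrow> 'a \<Rightarrow> 'b) \<Rightarrow> bool" where
  "is_epi S \<Sigma> A B h \<longleftrightarrow> is_hom S \<Sigma> A B h \<and> (\<forall>s\<in>S. h s ` carr A s = carr B s)"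

definition prod_algebra :: "'s set \<Rightarrow> ('s, 'f) signature \<Rightarrow> 'i set \<Rightarrow>
    ('i \<Rightarrow> ('s, 'f, 'a) sorted_algebra) \<Rightarrow> ('s, 'f, 'i \<Rightarrow> 'a) sorted_algebra" where
  "prod_algebra S \<Sigma> I C =
     \<lparr>carr = (\<lambda>s\<in>S. \<Pi>\<^sub>E i\<in>I. carr (C i) s),
      oper = (\<lambda>w s \<sigma>. if w \<in> lists S \<and> s \<in> S \<and> \<sigma> \<in> \<Sigma> w s
        then \<lambda>x\<in>word_prod (\<lambda>s. \<Pi>\<^sub>E i\<in>I. carr (C i) s) w.
               \<lambda>i\<in>I. oper (C i) w s \<sigma> (\<lambda>j\<in>{..<length w}. x j i)
        else undefined)\<rparr>"

definition is_subdirect_embedding :: "'s set \<Rightarrow> ('s, 'f) signature \<Rightarrow> 'i set \<Rightarrow>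
    ('s, 'f, 'a) sorted_algebra \<Rightarrow> ('i \<Rightarrow> ('s, 'f, 'b) sorted_algebra) \<Rightarrow>
    ('s \<Rightarrow> 'a \<Rightarrow> 'i \<Rightarrow> 'b) \<Rightarrow> bool" where
  "is_subdirect_embedding S \<Sigma> I A C f \<longleftrightarrow>
     is_hom S \<Sigma> A (prod_algebra S \<Sigma> I C) f \<and>
     (\<forall>s\<in>S. inj_on (f s) (carr A s)) \<and>
     (\<forall>i\<in>I. \<forall>s\<in>S. (\<lambda>a. f s a i) ` carr A s = carr (C i) s)"

section \<open>Formations\<close>

definition is_formation :: "('u \<Rightarrow> 'u set) \<Rightarrow> 's set \<Rightarrow> ('s, 'f) signature \<Rightarrow>
    ('s, 'f, 'u) sorted_algebra set \<Rightarrow> bool" where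
  "is_formation elts S \<Sigma> F \<longleftrightarrow>
     F \<subseteq> Alg elts S \<Sigma> \<and>
     F \<noteq> {} \<and>
     (\<forall>B\<in>F. \<forall>A\<in>Alg elts S \<Sigma>. (\<exists>h. is_iso S \<Sigma> B A h) \<longrightarrow> A \<in> F) \<and>
     (\<forall>B\<in>F. \<forall>A\<in>Alg elts S \<Sigma>. (\<exists>h. is_epi S \<Sigma> B A h) \<longrightarrow> A \<in> F) \<and>
     (\<forall>A\<in>Alg elts S \<Sigma>. \<forall>(n::nat) C.
        (\<forall>\<alpha><n. C \<alpha> \<in> F) \<and> (\<exists>f. is_subdirect_embedding S \<Sigma> {..<n} A C f) \<longrightarrow> A \<in> F)"

definition Form :: "('u \<Rightarrow> 'u set) \<Rightarrow> 's set \<Rightarrow> ('s, 'f) signature \<Rightarrow>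
    ('s, 'f, 'u) sorted_algebra set gorder" where
  "Form elts S \<Sigma> = \<lparr>carrier = {F. is_formation elts S \<Sigma> F}, eq = (=), le = (\<subseteq>)\<rparr>"

definition Fmg :: "('u \<Rightarrow> 'u set) \<Rightarrow> 's set \<Rightarrow> ('s, 'f) signature \<Rightarrow>
    ('s, 'f, 'u) sorted_algebra set \<Rightarrow> ('s, 'f, 'u) sorted_algebra set" where
  "Fmg elts S \<Sigma> M = \<Inter> {F. is_formation elts S \<Sigma> F \<and> M \<subseteq> F}"

section \<open>Algebraic lattices\<close>

definition compact_element :: "('a, 'b) gorder_scheme \<Rightarrow> 'a \<Rightarrow> bool" where
  "compact_element L x \<longleftrightarrow> x \<in> carrier L \<and>
     (\<forall>A. A \<subseteq> carrier L \<and> x \<sqsubseteq>\<^bsub>L\<^esub> \<Squnion>\<^bsub>L\<^esub>A \<longrightarrow> (\<exists>B. B \<subseteq> A \<and> finite B \<and> x \<sqsubseteq>\<^bsub>L\<^esub> \<Squnion>\<^bsub>L\<^esub>B))"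

definition algebraic_lattice :: "('a, 'b) gorder_scheme \<Rightarrow> bool" where
  "algebraic_lattice L \<longleftrightarrow> complete_lattice L \<and>
     (\<forall>x\<in>carrier L. \<exists>K. (\<forall>k\<in>K. compact_element L k) \<and> x = \<Squnion>\<^bsub>L\<^esub>K)"

end

theory Submission
  imports Defs
begin

text \<open>
  Every closure condition of a formation has finitely many premises, and the condition with no
  premises puts the trivial algebra into every formation. Hence intersections and directed unions
  of formations are formations, and the theorem is an instance of the theory of algebraic closure
  systems: a closure operator commuting with directed unions satisfies
  \<open>cl M = \<Union> {cl N | N \<subseteq> M finite}\<close>, which makes the finitely generated closed sets exactly
  the compact ones.
\<close>

section \<open>Algebraic closure systems\<close>

text \<open>Directedness asks for a bound of every finite subfamily, including the empty one, so a
  directed \<open>D\<close> is nonempty. The top \<open>U\<close> is a separate axiom because in HOL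
  the empty intersection is \<open>UNIV\<close> and not \<open>U\<close>.\<close>

locale algebraic_closure_system =
  fixes U :: "'a set" and C :: "'a set set"
  assumes closed_subset: "X \<in> C \<Longrightarrow> X \<subseteq> U"
    and base_closed: "U \<in> C"
    and Inter_closed: "D \<subseteq> C \<Longrightarrow> D \<noteq> {} \<Longrightarrow> \<Inter>D \<in> C"
    and directed_Union_closed:
      "D \<subseteq> C \<Longrightarrow> (\<And>B. finite B \<Longrightarrow> B \<subseteq> D \<Longrightarrow> \<exists>Y\<in>D. \<Union>B \<subseteq> Y) \<Longrightarrow> \<Union>D \<in> C"
begin

text \<open>If \<open>M\<close> is not contained in \<open>U\<close>, no closed set contains it and
  \<open>cl M\<close> is \<open>UNIV\<close>; hence the condition \<open>M \<subseteq> U\<close>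
  wherever \<open>cl M\<close> has to be closed.\<close>

definition cl :: "'a set \<Rightarrow> 'a set" where
  "cl M = \<Inter> {X \<in> C. M \<subseteq> X}"

definition lat :: "'a set gorder" where
  "lat = \<lparr>carrier = C, eq = (=), le = (\<subseteq>)\<rparr>"

lemma lat_simps [simp]:
  "carrier lat = C" "eq lat = (=)" "le lat = (\<subseteq>)"
  by (simp_all add: lat_def)

section \<open>The closure operator and its finitary character\<close>

lemma cl_extensive: "M \<subseteq> cl M"
  by (auto simp: cl_def)

lemma cl_least: "X \<in> C \<Longrightarrow> M \<subseteq> X \<Longrightarrow> cl M \<subseteq> X"
  by (auto simp: cl_def)

lemma cl_closed: "M \<subseteq> U \<Longrightarrow> cl M \<in> C"
  unfolding cl_def using base_closed by (intro Inter_closed) auto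

lemma cl_mono: "M \<subseteq> N \<Longrightarrow> cl M \<subseteq> cl N"
  by (auto simp: cl_def)

text \<open>Finitely many finite subsets of \<open>M\<close> have a finite union, whose closure
  bounds theirs. So the closures of finite subsets form a directed family; its union is closed and
  contains \<open>M\<close> through the singletons.\<close>

lemma cl_eq_Union_finite:
  assumes "M \<subseteq> U"
  shows "cl M = \<Union> (cl ` {N. finite N \<and> N \<subseteq> M})"
proof (rule antisym)
  have "\<Union> (cl ` {N. finite N \<and> N \<subseteq> M}) \<in> C"
  proof (rule directed_Union_closed)
    show "cl ` {N. finite N \<and> N \<subseteq> M} \<subseteq> C"
      using assms cl_closed by blast
  next
    fix B assume "finite B" "B \<subseteq> cl ` {N. finite N \<and> N \<subseteq> M}"
    then obtain K where K: "finite K" "K \<subseteq> {N. finite N \<and> N \<subseteq> M}" "B = cl ` K"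
      by (meson finite_subset_image)
    have "\<Union>B \<subseteq> cl (\<Union>K)"
      using K(3) cl_mono by (metis SUP_least Union_upper)
    moreover have "finite (\<Union>K)" "\<Union>K \<subseteq> M"
      using K by auto
    ultimately show "\<exists>Y\<in>cl ` {N. finite N \<and> N \<subseteq> M}. \<Union>B \<subseteq> Y"
      by blast
  qed
  moreover have "M \<subseteq> \<Union> (cl ` {N. finite N \<and> N \<subseteq> M})"
  proof
    fix m assume "m \<in> M"
    then show "m \<in> \<Union> (cl ` {N. finite N \<and> N \<subseteq> M})"
      using cl_extensive[of "{m}"] by (intro UN_I[of "{m}"]) auto
  qed
  ultimately show "cl M \<subseteq> \<Union> (cl ` {N. finite N \<and> N \<subseteq> M})"
    by (rule cl_least)
  show "\<Union> (cl ` {N. finite N \<and> N \<subseteq> M}) \<subseteq> cl M"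
    using cl_mono by blast
qed

text \<open>Each of the finitely many points of \<open>K\<close> needs only finitely many generators
  from \<open>M\<close>; the union of these sets serves for all of \<open>K\<close>.\<close>

lemma finite_subset_cl:
  assumes "M \<subseteq> U" "finite K" "K \<subseteq> cl M"
  obtains N where "finite N" "N \<subseteq> M" "K \<subseteq> cl N"
proof -
  have "\<forall>k\<in>K. \<exists>N. finite N \<and> N \<subseteq> M \<and> k \<in> cl N"
    using assms(3) unfolding cl_eq_Union_finite[OF assms(1)] by blast
  then obtain g where g: "\<And>k. k \<in> K \<Longrightarrow> finite (g k) \<and> g k \<subseteq> M \<and> k \<in> cl (g k)"
    by metis
  show thesis
  proof (rule that)
    show "finite (\<Union> (g ` K))" "\<Union> (g ` K) \<subseteq> M"
      using g assms(2) by auto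
    show "K \<subseteq> cl (\<Union> (g ` K))"
      using g cl_mono by (metis UN_upper subset_eq)
  qed
qed

section \<open>The complete lattice of closed sets\<close>

sublocale lat: partial_order lat
  by unfold_locales auto

lemma least_Upper: "D \<subseteq> C \<Longrightarrow> least lat (cl (\<Union>D)) (Upper lat D)"
proof (rule least_UpperI)
  assume D: "D \<subseteq> C"
  then show "D \<subseteq> carrier lat" "cl (\<Union>D) \<in> carrier lat"
    using closed_subset by (auto intro!: cl_closed)
  show "X \<sqsubseteq>\<^bsub>lat\<^esub> cl (\<Union>D)" if "X \<in> D" for X
    using order_trans[OF Union_upper[OF that] cl_extensive] by simp
  show "cl (\<Union>D) \<sqsubseteq>\<^bsub>lat\<^esub> Y" if "Y \<in> Upper lat D" for Y
  proof -
    have "Y \<in> C" "\<Union>D \<subseteq> Y"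
      using that D by (auto simp: Upper_def)
    then show ?thesis
      by (simp add: cl_least)
  qed
qed

text \<open>The join is defined by a choice operator, so its value follows from uniqueness of least
  upper bounds.\<close>

lemma sup_eq_cl: "D \<subseteq> C \<Longrightarrow> \<Squnion>\<^bsub>lat\<^esub>D = cl (\<Union>D)"
  unfolding sup_def
  by (intro some_equality least_Upper lat.least_unique[OF _ least_Upper])

text \<open>Intersecting with \<open>U\<close> covers the case of empty \<open>D\<close>, where the
  meet must be the top element.\<close>

lemma greatest_Lower:
  assumes "D \<subseteq> C"
  shows "greatest lat (U \<inter> \<Inter>D) (Lower lat D)"
proof (rule greatest_LowerI)
  show "D \<subseteq> carrier lat" "U \<inter> \<Inter>D \<in> carrier lat"
    \<comment> \<open>Adding \<open>U\<close> to the family makes it nonempty and turns the meet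
      into a plain intersection.\<close>
    using assms base_closed Inter_closed[of "insert U D"] by auto
  show "U \<inter> \<Inter>D \<sqsubseteq>\<^bsub>lat\<^esub> X" if "X \<in> D" for X
    using that by auto
  show "Y \<sqsubseteq>\<^bsub>lat\<^esub> U \<inter> \<Inter>D" if "Y \<in> Lower lat D" for Y
    using that assms closed_subset by (auto simp: Lower_def)
qed

lemma complete_lattice_lat: "complete_lattice lat"
proof
  show "\<exists>s. least lat s (Upper lat D)" if "D \<subseteq> carrier lat" for D
    using least_Upper that by auto
  show "\<exists>i. greatest lat i (Lower lat D)" if "D \<subseteq> carrier lat" for D
    using greatest_Lower that by auto
qed

section \<open>Compact elements and algebraicity\<close>

lemma cl_Union_singletons:
  assumes "X \<in> C" "M \<subseteq> X"
  shows "cl (\<Union>m\<in>M. cl {m}) = cl M"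
proof (rule antisym)
  \<comment> \<open>The closed set \<open>X\<close> serves to place \<open>M\<close> inside
    \<open>U\<close>.\<close>
  have "cl M \<in> C"
    using assms closed_subset by (blast intro: cl_closed)
  moreover have "(\<Union>m\<in>M. cl {m}) \<subseteq> cl M"
    by (intro UN_least cl_mono) simp
  ultimately show "cl (\<Union>m\<in>M. cl {m}) \<subseteq> cl M"
    by (rule cl_least)
  show "cl M \<subseteq> cl (\<Union>m\<in>M. cl {m})"
    using cl_extensive by (intro cl_mono) blast
qed

text \<open>A compact \<open>X\<close> is the join of the closures of its points, and a finite
  subfamily that suffices yields finite generators. Conversely, if a finite \<open>M\<close> lies in
  the closure of \<Union>A, it lies in the closure of a finite \<open>N\<close> \<subseteq>
  \<Union>A, and finitely many members of \<open>A\<close> cover \<open>N\<close>.\<close>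

lemma compact_element_iff:
  assumes "X \<in> C"
  shows "compact_element lat X \<longleftrightarrow> (\<exists>M. finite M \<and> M \<subseteq> U \<and> X = cl M)"
proof
  assume X: "compact_element lat X"
  let ?D = "(\<lambda>m. cl {m}) ` X"
  have D: "?D \<subseteq> C"
    using assms closed_subset by (auto intro!: cl_closed)
  have "X \<sqsubseteq>\<^bsub>lat\<^esub> \<Squnion>\<^bsub>lat\<^esub>?D"
    using cl_extensive by (simp add: sup_eq_cl[OF D] cl_Union_singletons[OF assms order_refl])
  then obtain B where B: "B \<subseteq> ?D" "finite B" "X \<subseteq> \<Squnion>\<^bsub>lat\<^esub>B"
    using X D unfolding compact_element_def lat_simps by blast
  obtain M where M: "M \<subseteq> X" "finite M" "B = (\<lambda>m. cl {m}) ` M"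
    using finite_subset_image[OF B(2,1)] by blast
  have "X \<subseteq> cl M"
    using B D sup_eq_cl[of B] cl_Union_singletons[OF assms M(1)] M(3) by auto
  then have "X = cl M"
    using cl_least[OF assms M(1)] by blast
  then show "\<exists>M. finite M \<and> M \<subseteq> U \<and> X = cl M"
    using M closed_subset[OF assms] by blast
next
  assume "\<exists>M. finite M \<and> M \<subseteq> U \<and> X = cl M"
  then obtain M where M: "finite M" "X = cl M"
    by blast
  show "compact_element lat X"
    unfolding compact_element_def lat_simps
  proof (intro conjI allI impI assms)
    fix A assume A: "A \<subseteq> C \<and> X \<subseteq> \<Squnion>\<^bsub>lat\<^esub>A"
    then have "M \<subseteq> cl (\<Union>A)"
      using cl_extensive[of M] M(2) by (auto simp: sup_eq_cl)
    moreover have "\<Union>A \<subseteq> U"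
      using A closed_subset by blast
    ultimately obtain N where N: "finite N" "N \<subseteq> \<Union>A" "M \<subseteq> cl N"
      using M(1) finite_subset_cl by metis
    obtain B where B: "finite B" "B \<subseteq> A" "N \<subseteq> \<Union>B"
      using finite_subset_Union[OF N(1,2)] by blast
    have "M \<subseteq> cl (\<Union>B)"
      using N(3) cl_mono[OF B(3)] by blast
    moreover have "cl (\<Union>B) \<in> C"
      using A B(2) closed_subset by (intro cl_closed) blast
    ultimately have "X \<subseteq> cl (\<Union>B)"
      unfolding M(2) by (intro cl_least)
    moreover have "\<Squnion>\<^bsub>lat\<^esub>B = cl (\<Union>B)"
      using A B(2) by (intro sup_eq_cl) blast
    ultimately show "\<exists>B. B \<subseteq> A \<and> finite B \<and> X \<subseteq> \<Squnion>\<^bsub>lat\<^esub>B"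
      using B by auto
  qed
qed

text \<open>A closed set is the join of the closures of its points, each compact because it has a
  single generator.\<close>

lemma algebraic_lattice_lat: "algebraic_lattice lat"
  unfolding algebraic_lattice_def lat_simps
proof (intro conjI ballI complete_lattice_lat)
  fix X assume X: "X \<in> C"
  let ?D = "(\<lambda>m. cl {m}) ` X"
  have D: "?D \<subseteq> C"
    using X closed_subset by (auto intro!: cl_closed)
  have "compact_element lat (cl {m})" if "m \<in> X" for m
  proof -
    have "cl {m} \<in> C" "{m} \<subseteq> U"
      using that D closed_subset[OF X] by auto
    then show ?thesis
      by (subst compact_element_iff) (auto intro!: exI[of _ "{m}"])
  qed
  then have "\<forall>k\<in>?D. compact_element lat k"
    by simp
  moreover have "X = \<Squnion>\<^bsub>lat\<^esub>?D"
    unfolding sup_eq_cl[OF D] cl_Union_singletons[OF X order_refl]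
    by (rule antisym[OF cl_extensive cl_least[OF X order_refl]])
  ultimately show "\<exists>K. (\<forall>k\<in>K. compact_element lat k) \<and> X = \<Squnion>\<^bsub>lat\<^esub>K"
    by (intro exI[of _ ?D] conjI)
qed

end

section \<open>Formations\<close>

text \<open>A copy of the final algebra with elements in the universe: the empty product itself has
  functions as elements and another type. Values off the domains are \<open>undefined\<close>, as
  \<open>is_algebra\<close> demands.\<close>

definition trivial_algebra :: "'s set \<Rightarrow> ('s, 'f) signature \<Rightarrow> 'a \<Rightarrow> ('s, 'f, 'a) sorted_algebra" where
  "trivial_algebra S \<Sigma> a =
     \<lparr>carr = (\<lambda>s\<in>S. {a}),
      oper = (\<lambda>w s \<sigma>. if w \<in> lists S \<and> s \<in> S \<and> \<sigma> \<in> \<Sigma> w s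
        then \<lambda>x\<in>word_prod (\<lambda>s\<in>S. {a}) w. a else undefined)\<rparr>"

lemma trivial_algebra_in_Alg:
  assumes "grothendieck_universe elts"
  shows "trivial_algebra S \<Sigma> a \<in> Alg elts S \<Sigma>"
proof -
  have "{a} \<in> range elts"
    using grothendieck_universe.pair[OF assms, of a a] by simp
  moreover have "(\<lambda>x\<in>X. a) \<in> X \<rightarrow>\<^sub>E {a}" for X :: "(nat \<Rightarrow> 'a) set"
    by simp
  ultimately show ?thesis
    by (simp add: trivial_algebra_def Alg_def is_algebra_def)
qed

text \<open>The empty product has exactly one element in each sort, the everywhere
  \<open>undefined\<close> function. Injectivity holds on singletons, and there are no projections
  to check.\<close>

lemma subdirect_embedding_trivial_algebra:
  "is_subdirect_embedding S \<Sigma> {} (trivial_algebra S \<Sigma> a) C (\<lambda>s x i. undefined)"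
  unfolding is_subdirect_embedding_def is_hom_def
  by (intro conjI ballI) (simp_all add: prod_algebra_def trivial_algebra_def word_prod_def
      restrict_def)

section \<open>Intersections and directed unions of formations\<close>

lemma formation_iso:
  "is_formation elts S \<Sigma> F \<Longrightarrow> B \<in> F \<Longrightarrow> A \<in> Alg elts S \<Sigma> \<Longrightarrow> is_iso S \<Sigma> B A h \<Longrightarrow> A \<in> F"
  unfolding is_formation_def by blast

lemma formation_epi:
  "is_formation elts S \<Sigma> F \<Longrightarrow> B \<in> F \<Longrightarrow> A \<in> Alg elts S \<Sigma> \<Longrightarrow> is_epi S \<Sigma> B A h \<Longrightarrow> A \<in> F"
  unfolding is_formation_def by blast

lemma formation_subdirect:
  fixes n :: nat
  shows "is_formation elts S \<Sigma> F \<Longrightarrow> (\<And>i. i < n \<Longrightarrow> C i \<in> F) \<Longrightarrow> A \<in> Alg elts S \<Sigma> \<Longrightarrow>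
    is_subdirect_embedding S \<Sigma> {..<n} A C f \<Longrightarrow> A \<in> F"
  unfolding is_formation_def by blast

text \<open>This is the subdirect condition with \<open>n = 0\<close>, which has no premises on
  factors. It gives all formations a common member.\<close>

lemma trivial_algebra_in_formation:
  assumes "grothendieck_universe elts" "is_formation elts S \<Sigma> F"
  shows "trivial_algebra S \<Sigma> a \<in> F"
proof (rule formation_subdirect[OF assms(2) _ trivial_algebra_in_Alg[OF assms(1)]])
  show "is_subdirect_embedding S \<Sigma> {..<0::nat} (trivial_algebra S \<Sigma> a) C (\<lambda>s x i. undefined)" for C
    using subdirect_embedding_trivial_algebra by simp
qed simp

lemma formationI:
  assumes "F \<subseteq> Alg elts S \<Sigma>" "F \<noteq> {}"
    and "\<And>A B h. B \<in> F \<Longrightarrow> A \<in> Alg elts S \<Sigma> \<Longrightarrow> is_iso S \<Sigma> B A h \<Longrightarrow> A \<in> F"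
    and "\<And>A B h. B \<in> F \<Longrightarrow> A \<in> Alg elts S \<Sigma> \<Longrightarrow> is_epi S \<Sigma> B A h \<Longrightarrow> A \<in> F"
    and "\<And>A (n::nat) C f. (\<And>i. i < n \<Longrightarrow> C i \<in> F) \<Longrightarrow> A \<in> Alg elts S \<Sigma> \<Longrightarrow>
      is_subdirect_embedding S \<Sigma> {..<n} A C f \<Longrightarrow> A \<in> F"
  shows "is_formation elts S \<Sigma> F"
  unfolding is_formation_def using assms by blast

lemma formation_subset_Alg: "is_formation elts S \<Sigma> F \<Longrightarrow> F \<subseteq> Alg elts S \<Sigma>"
  by (simp add: is_formation_def)

lemma formation_Alg:
  assumes "grothendieck_universe elts"
  shows "is_formation elts S \<Sigma> (Alg elts S \<Sigma>)"
  using trivial_algebra_in_Alg[OF assms] by (intro formationI) auto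

text \<open>The common trivial algebra keeps the intersection nonempty; the closure conditions pass
  to it memberwise.\<close>

lemma formation_Inter:
  assumes "grothendieck_universe elts" "D \<noteq> {}" and D: "\<And>F. F \<in> D \<Longrightarrow> is_formation elts S \<Sigma> F"
  shows "is_formation elts S \<Sigma> (\<Inter>D)"
proof (rule formationI)
  show "\<Inter>D \<subseteq> Alg elts S \<Sigma>"
    using assms(2) formation_subset_Alg[OF D] by blast
  show "\<Inter>D \<noteq> {}"
    using trivial_algebra_in_formation[OF assms(1) D] by blast
next
  fix A B h assume "B \<in> \<Inter>D" "A \<in> Alg elts S \<Sigma>" "is_iso S \<Sigma> B A h"
  then show "A \<in> \<Inter>D"
    using formation_iso[OF D] by blast
next
  fix A B h assume "B \<in> \<Inter>D" "A \<in> Alg elts S \<Sigma>" "is_epi S \<Sigma> B A h"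
  then show "A \<in> \<Inter>D"
    using formation_epi[OF D] by blast
next
  fix A and n :: nat and C f
  assume "\<And>i. i < n \<Longrightarrow> C i \<in> \<Inter>D" "A \<in> Alg elts S \<Sigma>" "is_subdirect_embedding S \<Sigma> {..<n} A C f"
  then show "A \<in> \<Inter>D"
    by (auto intro: formation_subdirect[OF D])
qed

text \<open>A subdirect embedding involves only finitely many factors. Finitely many members of
  \<open>D\<close> contain them all, and directedness puts these inside one formation, which then
  contains \<open>A\<close>.\<close>

lemma formation_directed_Union:
  assumes D: "\<And>F. F \<in> D \<Longrightarrow> is_formation elts S \<Sigma> F"
    and directed: "\<And>B. finite B \<Longrightarrow> B \<subseteq> D \<Longrightarrow> \<exists>F\<in>D. \<Union>B \<subseteq> F"
  shows "is_formation elts S \<Sigma> (\<Union>D)"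
proof (rule formationI)
  show "\<Union>D \<subseteq> Alg elts S \<Sigma>"
    using formation_subset_Alg[OF D] by blast
  obtain F where "F \<in> D"
    \<comment> \<open>The bound of the empty subfamily shows that \<open>D\<close> is
      nonempty.\<close>
    using directed[of "{}"] by auto
  then show "\<Union>D \<noteq> {}"
    using D[of F] unfolding is_formation_def by blast
next
  fix A B h assume "B \<in> \<Union>D" "A \<in> Alg elts S \<Sigma>" "is_iso S \<Sigma> B A h"
  then show "A \<in> \<Union>D"
    using formation_iso[OF D] by blast
next
  fix A B h assume "B \<in> \<Union>D" "A \<in> Alg elts S \<Sigma>" "is_epi S \<Sigma> B A h"
  then show "A \<in> \<Union>D"
    using formation_epi[OF D] by blast
next
  fix A and n :: nat and C f
  assume *: "\<And>i. i < n \<Longrightarrow> C i \<in> \<Union>D" "A \<in> Alg elts S \<Sigma>" "is_subdirect_embedding S \<Sigma> {..<n} A C f"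
  have "finite (C ` {..<n})" "C ` {..<n} \<subseteq> \<Union>D"
    using *(1) by auto
  then obtain B where B: "finite B" "B \<subseteq> D" "C ` {..<n} \<subseteq> \<Union>B"
    using finite_subset_Union by metis
  obtain F where F: "F \<in> D" "\<Union>B \<subseteq> F"
    using directed[OF B(1,2)] by blast
  have "A \<in> F"
    using B(3) F(2) by (intro formation_subdirect[OF D[OF F(1)] _ *(2,3)]) blast
  then show "A \<in> \<Union>D"
    using F(1) by blast
qed

lemma algebraic_closure_system_formations:
  assumes "grothendieck_universe elts"
  shows "algebraic_closure_system (Alg elts S \<Sigma>) {F. is_formation elts S \<Sigma> F}"
proof (unfold_locales, unfold mem_Collect_eq)
  show "F \<subseteq> Alg elts S \<Sigma>" if "is_formation elts S \<Sigma> F" for F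
    using that by (rule formation_subset_Alg)
  show "is_formation elts S \<Sigma> (Alg elts S \<Sigma>)"
    using assms by (rule formation_Alg)
  show "is_formation elts S \<Sigma> (\<Inter>D)"
    if "D \<subseteq> {F. is_formation elts S \<Sigma> F}" "D \<noteq> {}" for D
    using that by (intro formation_Inter[OF assms]) auto
  show "is_formation elts S \<Sigma> (\<Union>D)"
    if "D \<subseteq> {F. is_formation elts S \<Sigma> F}"
      and "\<And>B. finite B \<Longrightarrow> B \<subseteq> D \<Longrightarrow> \<exists>Y\<in>D. \<Union>B \<subseteq> Y" for D
  proof (rule formation_directed_Union)
    show "is_formation elts S \<Sigma> F" if "F \<in> D" for F
      using \<open>D \<subseteq> _\<close> that by auto
  qed (rule that(2))
qed

theorem corollary3p13:
  fixes elts :: "'u \<Rightarrow> 'u set"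
    and S :: "'u set"
    and \<Sigma> :: "('u, 'u) signature"
  assumes "grothendieck_universe elts"
    and "S \<in> range elts"
    and "\<And>w s. w \<in> lists S \<Longrightarrow> s \<in> S \<Longrightarrow> \<Sigma> w s \<in> range elts"
  shows "algebraic_lattice (Form elts S \<Sigma>) \<and>
    (\<forall>F. is_formation elts S \<Sigma> F \<longrightarrow>
      (compact_element (Form elts S \<Sigma>) F \<longleftrightarrow>
        (\<exists>M. finite M \<and> M \<subseteq> Alg elts S \<Sigma> \<and> F = Fmg elts S \<Sigma> M)))"
proof -
  interpret algebraic_closure_system "Alg elts S \<Sigma>" "{F. is_formation elts S \<Sigma> F}"
    by (rule algebraic_closure_system_formations[OF assms(1)])
  \<comment> \<open>With formations as closed sets, the abstract lattice and closure operator unfold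
    to \<open>Form\<close> and \<open>Fmg\<close>, so the general results transfer by
    rewriting.\<close>
  have "lat = Form elts S \<Sigma>"
    by (simp add: lat_def Form_def)
  moreover have "cl M = Fmg elts S \<Sigma> M" for M
    by (simp add: cl_def Fmg_def)
  ultimately show ?thesis
    using algebraic_lattice_lat compact_element_iff by simp
qed

end
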